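(* Let $1\le r\le\infty$ and let $P=U(\mathbb R^p)$ and $Q=V(\mathbb R^q)$ be nonzero linear subspaces of $\mathbb R^n$, where $U\in\mathbb R^{n\times p}$ and $V\in\mathbb R^{n\times q}$ have orthonormal columns. Let $\theta_{\max}(P,Q)\in[0,\pi/2]$ be defined by $\cos\theta_{\max}(P,Q)=\sigma_{\min}(V^\top U)$, the smallest singular value of $V^\top U$. Then $${\rm Dis}_r(P,Q)=2\left\|\left(\tfrac{\sqrt2}{2},\ \sin\left[\tfrac{\theta_{\max}(P,Q)}{2}\right]\right)\right\|_r\quad\text{if } p\ne q,$$ $${\rm Dis}_r(P,Q)=2\|(1,1)\|_r\,\sin\left[\tfrac{\theta_{\max}(P,Q)}{2}\right]\quad\text{if } p=q.$$
   Context: $S_n$ is the unit sphere of $\mathbb R^n$. For nonzero closed convex cones $P,Q$: $\Theta(P,Q):=\max_{u\in P\cap S_n}\min_{v\in Q\cap S_n}\arccos\langle u,v\rangle$ and ${\rm Dis}_r(P,Q):=2\left\|\left(\sin[\Theta(P,Q)/2],\ \sin[\Theta(Q,P)/2]\right)\right\|_r$, where $\|\cdot\|_r$ is the $\ell^r$-norm on $\mathbb R^2$. (Equivalently ${\rm Dis}_r(P,Q)=\|(\Lambda(P\cap S_n,Q\cap S_n),\Lambda(Q\cap S_n,P\cap S_n))\|_r$ with $\Lambda(C,D)=\max_{x\in C}\min_{y\in D}\|x-y\|$.) $\theta_{\max}(P,Q)$ is the largest principal angle between $P$ and $Q$. *)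

theory Defs
  imports "HOL-Analysis.Analysis" "HOL-Library.Extended_Real"
begin

text \<open>Angle Theta(P,Q) = max over unit u in P of min over unit v in Q of arccos(u . v).\<close>
definition cone_angle :: "('a::real_inner) set \<Rightarrow> 'a set \<Rightarrow> real" where
  "cone_angle P Q = (SUP u \<in> P \<inter> sphere 0 1. INF v \<in> Q \<inter> sphere 0 1. arccos (inner u v))"

text \<open>l^r norm on R^2, r in [1, infinity] (ereal).\<close>
definition lr_norm2 :: "ereal \<Rightarrow> real \<Rightarrow> real \<Rightarrow> real" where
  "lr_norm2 r a b = (if r = \<infinity> then max \<bar>a\<bar> \<bar>b\<bar>
     else (\<bar>a\<bar> powr real_of_ereal r + \<bar>b\<bar> powr real_of_ereal r) powr (1 / real_of_ereal r))"

definition Dis :: "ereal \<Rightarrow> ('a::real_inner) set \<Rightarrow> 'a set \<Rightarrow> real" where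
  "Dis r P Q = 2 * lr_norm2 r (sin (cone_angle P Q / 2)) (sin (cone_angle Q P / 2))"

text \<open>Real eigenvalues of a square matrix.\<close>
definition eigenvalues :: "real^'k^'k \<Rightarrow> real set" where
  "eigenvalues M = {c. \<exists>x. x \<noteq> 0 \<and> M *v x = c *\<^sub>R x}"

text \<open>Smallest singular value of a q x p matrix A (rows 'q, columns 'p): the smallest of
  its min(p,q) singular values, i.e. sqrt of the smallest eigenvalue of the smaller Gram matrix.\<close>
definition sigma_min :: "real^'p^'q \<Rightarrow> real" where
  "sigma_min A = (if CARD('p) \<le> CARD('q)
      then sqrt (Inf (eigenvalues (transpose A ** A)))
      else sqrt (Inf (eigenvalues (A ** transpose A))))"

text \<open>theta_max in [0, pi/2] with cos theta_max = sigma_min(V^T U).\<close>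
definition theta_max :: "real^'p^'n \<Rightarrow> real^'q^'n \<Rightarrow> real" where
  "theta_max U V = arccos (sigma_min (transpose V ** U))"

end

theory Submission
  imports Defs
begin

text \<open>
  Let \<open>P = range U\<close>, \<open>Q = range V\<close> with \<open>U\<close>, \<open>V\<close> having orthonormal columns. The unit vectors
  of \<open>P\<close> are the \<open>U x\<close> with \<open>|x| = 1\<close>, and the unit vector of \<open>Q\<close> closest to \<open>U x\<close> makes the
  angle \<open>arccos |V\<^sup>T U x|\<close> with it. Hence \<open>\<Theta>(P,Q) = arccos m(V\<^sup>T U)\<close> and
  \<open>\<Theta>(Q,P) = arccos m(U\<^sup>T V)\<close>, where \<open>m(A) = min {|A x| | |x| = 1}\<close> is the minimum modulus.
  A minimiser of the Rayleigh quotient of \<open>A\<^sup>T A\<close> is an eigenvector, so \<open>m(A)\<close> is the square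
  root of the least eigenvalue of \<open>A\<^sup>T A\<close>. Moreover \<open>m(A) = 0\<close> iff \<open>A\<close> has a nontrivial kernel,
  which is forced when \<open>A\<close> has more columns than rows, and \<open>m(A\<^sup>T) = m(A)\<close> for square \<open>A\<close>.
  So for \<open>p \<noteq> q\<close> one of the two angles is \<open>\<pi>/2\<close> and the other is \<^const>\<open>theta_max\<close>, while for \<open>p = q\<close>
  both are \<^const>\<open>theta_max\<close>.
\<close>

lemma inner_matrix_vector_transpose: "(A *v x) \<bullet> (y::real^_) = x \<bullet> (transpose A *v y)"
  by (metis dot_lmul_matrix inner_commute transpose_matrix_vector)

lemma orthonormal_columns_inner:
  fixes V :: "real^'q^'n"
  assumes "transpose V ** V = mat 1"
  shows "(V *v x) \<bullet> (V *v y) = x \<bullet> y"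
  by (simp add: inner_matrix_vector_transpose matrix_vector_mul_assoc assms)

lemma orthonormal_columns_norm:
  fixes V :: "real^'q^'n"
  assumes "transpose V ** V = mat 1"
  shows "norm (V *v x) = norm x"
  by (simp add: norm_eq_sqrt_inner orthonormal_columns_inner[OF assms])

lemma orthonormal_columns_norm_transpose_le:
  fixes V :: "real^'q^'n"
  assumes "transpose V ** V = mat 1"
  shows "norm (transpose V *v u) \<le> norm u"
proof -
  let ?w = "transpose V *v u"
  have "norm ?w * norm ?w = ?w \<bullet> ?w"
    by (simp add: dot_square_norm power2_eq_square)
  also have "\<dots> = u \<bullet> (V *v ?w)"
    by (metis inner_matrix_vector_transpose inner_commute transpose_transpose)
  also have "\<dots> \<le> norm u * norm ?w"
    using norm_cauchy_schwarz orthonormal_columns_norm[OF assms] by metis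
  finally show ?thesis
    by (cases "?w = 0") auto
qed

lemma quadratic_nonneg_imp_linear_coeff_eq_0:
  fixes a d :: real
  assumes "\<And>t. 0 \<le> t * a + t\<^sup>2 * d"
  shows "a = 0"
proof (rule ccontr)
  assume "a \<noteq> 0"
  define c where "c = \<bar>d\<bar> + 1"
  have "c > 0" "d < c"
    by (auto simp: c_def)
  have "c\<^sup>2 * ((- a / c) * a + (- a / c)\<^sup>2 * d) = a\<^sup>2 * (d - c)"
    using \<open>c > 0\<close> by (simp add: field_simps power2_eq_square)
  also have "\<dots> < 0"
    using \<open>a \<noteq> 0\<close> \<open>d < c\<close> by (intro mult_pos_neg) auto
  finally show False
    using assms[of "- a / c"] \<open>c > 0\<close> by (simp add: mult_less_0_iff)
qed

lemma rayleigh_minimizer_eigenvector: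
  fixes M :: "real^'n^'n"
  assumes sym: "transpose M = M"
    and lower: "\<And>x. l * (x \<bullet> x) \<le> x \<bullet> (M *v x)"
    and attained: "x0 \<bullet> (M *v x0) = l * (x0 \<bullet> x0)"
  shows "M *v x0 = l *\<^sub>R x0"
proof -
  \<comment> \<open>Perturbing \<open>x0\<close> along the residual \<open>w\<close> would push the quotient below \<open>l\<close> unless \<open>w = 0\<close>.\<close>
  define w where "w = M *v x0 - l *\<^sub>R x0"
  have swap: "x0 \<bullet> (M *v w) = w \<bullet> (M *v x0)"
    by (metis inner_matrix_vector_transpose inner_commute sym)
  have w_Mx0: "w \<bullet> (M *v x0) = w \<bullet> w + l * (x0 \<bullet> w)"
    by (simp add: w_def inner_diff_left inner_diff_right inner_commute algebra_simps)
  have "0 \<le> t * (2 * (w \<bullet> w)) + t\<^sup>2 * (w \<bullet> (M *v w) - l * (w \<bullet> w))" for t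
  proof -
    have "l * ((x0 + t *\<^sub>R w) \<bullet> (x0 + t *\<^sub>R w)) \<le> (x0 + t *\<^sub>R w) \<bullet> (M *v (x0 + t *\<^sub>R w))"
      by (rule lower)
    then show ?thesis
      using attained swap w_Mx0
      by (simp add: matrix_vector_right_distrib matrix_vector_mult_scaleR inner_add_left
          inner_add_right inner_commute power2_eq_square algebra_simps)
  qed
  then have "w \<bullet> w = 0"
    using quadratic_nonneg_imp_linear_coeff_eq_0 by fastforce
  then show ?thesis
    by (simp add: w_def)
qed

text \<open>
  For a matrix with more columns than rows the minimum modulus is \<open>0\<close>, not the smallest of its
  singular values; this is why \<^const>\<open>sigma_min\<close> switches to the transpose in that case.
\<close>
definition min_modulus :: "real^'p^'q \<Rightarrow> real" where
  "min_modulus A = (INF x \<in> sphere 0 1. norm (A *v x))"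

lemma min_modulus_le:
  assumes "norm x = 1"
  shows "min_modulus A \<le> norm (A *v x)"
proof -
  have "bdd_below ((\<lambda>x. norm (A *v x)) ` sphere 0 1)"
    by (rule bdd_belowI2[of _ 0]) simp
  then show ?thesis
    unfolding min_modulus_def by (rule cINF_lower) (simp add: assms)
qed

lemma min_modulus_attained:
  fixes A :: "real^'p^'q"
  obtains x0 where "norm x0 = 1" "min_modulus A = norm (A *v x0)"
proof -
  have "continuous_on (sphere 0 1) (\<lambda>x. norm (A *v x))"
    by (intro continuous_intros matrix_vector_mult_linear_continuous_on[unfolded o_def])
  moreover have "sphere (0::real^'p) 1 \<noteq> {}"
    by simp
  ultimately obtain x0 where x0: "x0 \<in> sphere 0 1"
    and min: "\<And>x. x \<in> sphere 0 1 \<Longrightarrow> norm (A *v x0) \<le> norm (A *v x)"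
    using continuous_attains_inf[OF compact_sphere] by metis
  have "min_modulus A = norm (A *v x0)"
    unfolding min_modulus_def using x0 min by (intro cInf_eq_minimum) auto
  with x0 that show ?thesis
    by simp
qed

lemma min_modulus_nonneg: "min_modulus A \<ge> 0"
  by (metis min_modulus_attained norm_ge_zero)

lemma min_modulus_mult_norm_le: "min_modulus A * norm x \<le> norm (A *v x)"
proof (cases "x = 0")
  case False
  have "min_modulus A \<le> norm (A *v (x /\<^sub>R norm x))"
    using False by (intro min_modulus_le) simp
  then show ?thesis
    using False by (simp add: matrix_vector_mult_scaleR field_simps)
qed simp

lemma min_modulus_eq_0_iff: "min_modulus A = 0 \<longleftrightarrow> (\<exists>x. x \<noteq> 0 \<and> A *v x = 0)"
proof
  assume "min_modulus A = 0"
  then show "\<exists>x. x \<noteq> 0 \<and> A *v x = 0"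
    by (metis min_modulus_attained norm_eq_zero zero_neq_one norm_zero)
next
  assume "\<exists>x. x \<noteq> 0 \<and> A *v x = 0"
  then obtain x where "x \<noteq> 0" "A *v x = 0"
    by blast
  then have "min_modulus A * norm x \<le> 0"
    using min_modulus_mult_norm_le[of A x] by simp
  then show "min_modulus A = 0"
    using \<open>x \<noteq> 0\<close> min_modulus_nonneg[of A] by (simp add: mult_le_0_iff)
qed

lemma min_modulus_eq_0_iff_rank: "min_modulus (A :: real^'p^'q) = 0 \<longleftrightarrow> rank A \<noteq> CARD('p)"
  by (simp add: min_modulus_eq_0_iff matrix_nonfull_linear_equations_eq)

lemma inner_gram_eq_norm_power2: "x \<bullet> ((transpose A ** A) *v x) = (norm (A *v x))\<^sup>2"
  for A :: "real^'p^'q"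
  by (metis inner_matrix_vector_transpose matrix_vector_mul_assoc power2_norm_eq_inner)

lemma min_modulus_eigenvector:
  fixes A :: "real^'p^'q"
  assumes "norm x0 = 1" "min_modulus A = norm (A *v x0)"
  shows "(transpose A ** A) *v x0 = (min_modulus A)\<^sup>2 *\<^sub>R x0"
proof (rule rayleigh_minimizer_eigenvector)
  show "transpose (transpose A ** A) = transpose A ** A"
    by (simp add: matrix_transpose_mul)
  show "(min_modulus A)\<^sup>2 * (x \<bullet> x) \<le> x \<bullet> ((transpose A ** A) *v x)" for x
    using min_modulus_mult_norm_le[of A x] min_modulus_nonneg[of A]
    by (simp add: inner_gram_eq_norm_power2 dot_square_norm power_mult_distrib[symmetric] power_mono)
  show "x0 \<bullet> ((transpose A ** A) *v x0) = (min_modulus A)\<^sup>2 * (x0 \<bullet> x0)"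
    using assms by (simp add: inner_gram_eq_norm_power2 dot_square_norm)
qed

lemma sqrt_Inf_eigenvalues_gram: "sqrt (Inf (eigenvalues (transpose A ** A))) = min_modulus A"
proof -
  obtain x0 where x0: "norm x0 = 1" "min_modulus A = norm (A *v x0)"
    using min_modulus_attained by blast
  have "Inf (eigenvalues (transpose A ** A)) = (min_modulus A)\<^sup>2"
  proof (rule cInf_eq_minimum)
    show "(min_modulus A)\<^sup>2 \<in> eigenvalues (transpose A ** A)"
      unfolding eigenvalues_def using x0 min_modulus_eigenvector[OF x0]
      by (auto intro!: exI[of _ x0] simp del: transpose_matrix_vector)
  next
    fix c assume "c \<in> eigenvalues (transpose A ** A)"
    then obtain x where x: "x \<noteq> 0" "(transpose A ** A) *v x = c *\<^sub>R x"
      unfolding eigenvalues_def by blast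
    have "(min_modulus A * norm x)\<^sup>2 \<le> (norm (A *v x))\<^sup>2"
      by (intro power_mono min_modulus_mult_norm_le mult_nonneg_nonneg min_modulus_nonneg norm_ge_zero)
    also have "\<dots> = c * (norm x)\<^sup>2"
      using x by (simp flip: inner_gram_eq_norm_power2 add: dot_square_norm)
    finally show "(min_modulus A)\<^sup>2 \<le> c"
      using x by (simp add: power_mult_distrib)
  qed
  then show ?thesis
    using min_modulus_nonneg[of A] by simp
qed

lemma min_modulus_transpose_le:
  fixes A :: "real^'p^'q"
  assumes "min_modulus A \<noteq> 0"
  shows "min_modulus (transpose A) \<le> min_modulus A"
proof -
  obtain x0 where x0: "norm x0 = 1" "min_modulus A = norm (A *v x0)"
    using min_modulus_attained by blast
  define s where "s = min_modulus A"
  have "s > 0"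
    using assms min_modulus_nonneg[of A] by (simp add: s_def)
  define y where "y = (A *v x0) /\<^sub>R s"
  have "norm y = 1"
    using x0 \<open>s > 0\<close> by (simp add: y_def s_def)
  have "transpose A *v y = s *\<^sub>R x0"
    using min_modulus_eigenvector[OF x0] \<open>s > 0\<close>
    by (simp add: y_def s_def matrix_vector_mul_assoc matrix_vector_mult_scaleR power2_eq_square
        del: transpose_matrix_vector)
  then have "norm (transpose A *v y) = s"
    using x0 \<open>s > 0\<close> by (simp del: transpose_matrix_vector)
  with min_modulus_le[OF \<open>norm y = 1\<close>, of "transpose A"] show ?thesis
    by (simp add: s_def)
qed

lemma min_modulus_transpose:
  fixes A :: "real^'p^'q"
  assumes "CARD('p) = CARD('q)"
  shows "min_modulus (transpose A) = min_modulus A"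
proof (cases "min_modulus A = 0")
  case True
  then have "min_modulus (transpose A) = 0"
    using assms by (simp add: min_modulus_eq_0_iff_rank rank_transpose)
  with True show ?thesis
    by simp
next
  case False
  then have "min_modulus (transpose A) \<noteq> 0"
    using assms by (simp add: min_modulus_eq_0_iff_rank rank_transpose)
  then show ?thesis
    using min_modulus_transpose_le[OF False] min_modulus_transpose_le[of "transpose A"] by simp
qed

lemma sigma_min_eq_min_modulus:
  "sigma_min A = (if CARD('p) \<le> CARD('q) then min_modulus A else min_modulus (transpose A))"
  for A :: "real^'p^'q"
  by (simp add: sigma_min_def flip: sqrt_Inf_eigenvalues_gram)

lemma min_modulus_eq_0_if_card_lt:
  fixes A :: "real^'p^'q"
  assumes "CARD('q) < CARD('p)"
  shows "min_modulus A = 0"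
  using rank_bound[of A] assms by (simp add: min_modulus_eq_0_iff_rank)

lemma norm_transpose_mult_orthonormal_le:
  fixes U :: "real^'p^'n" and V :: "real^'q^'n"
  assumes U: "transpose U ** U = mat 1" and V: "transpose V ** V = mat 1"
  shows "norm ((transpose V ** U) *v x) \<le> norm x"
  using orthonormal_columns_norm_transpose_le[OF V, of "U *v x"] orthonormal_columns_norm[OF U]
  by (simp add: matrix_vector_mul_assoc del: transpose_matrix_vector)

lemma min_modulus_transpose_mult_orthonormal_le_1:
  fixes U :: "real^'p^'n" and V :: "real^'q^'n"
  assumes "transpose U ** U = mat 1" and "transpose V ** V = mat 1"
  shows "min_modulus (transpose V ** U) \<le> 1"
  by (metis min_modulus_attained norm_transpose_mult_orthonormal_le[OF assms])

lemma exists_unit_vector_inner_eq_norm: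
  fixes w :: "'a::euclidean_space"
  obtains y where "norm y = 1" "w \<bullet> y = norm w"
proof (cases "w = 0")
  case True
  then show ?thesis
    using that vector_choose_size[of 1] by auto
next
  case False
  then show ?thesis
    using that[of "w /\<^sub>R norm w"] by (simp add: dot_square_norm power2_eq_square)
qed

lemma INF_arccos_inner_orthonormal_range:
  fixes V :: "real^'q^'n"
  assumes V: "transpose V ** V = mat 1" and u: "norm u = 1"
  shows "(INF v \<in> range ((*v) V) \<inter> sphere 0 1. arccos (u \<bullet> v)) = arccos (norm (transpose V *v u))"
proof (rule cInf_eq_minimum)
  let ?w = "transpose V *v u"
  have w_le: "norm ?w \<le> 1"
    using orthonormal_columns_norm_transpose_le[OF V, of u] u by simp
  have inner_eq: "u \<bullet> (V *v y) = ?w \<bullet> y" for y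
    by (metis inner_matrix_vector_transpose inner_commute transpose_transpose)
  obtain y where y: "norm y = 1" "?w \<bullet> y = norm ?w"
    using exists_unit_vector_inner_eq_norm by blast
  then show "arccos (norm ?w) \<in> (\<lambda>v. arccos (u \<bullet> v)) ` (range ((*v) V) \<inter> sphere 0 1)"
    using orthonormal_columns_norm[OF V, of y] inner_eq[of y] by (auto intro!: image_eqI[of _ _ "V *v y"])
  fix z
  assume "z \<in> (\<lambda>v. arccos (u \<bullet> v)) ` (range ((*v) V) \<inter> sphere 0 1)"
  then obtain y where z: "z = arccos (u \<bullet> (V *v y))" and Vy: "norm (V *v y) = 1"
    by auto
  have "norm y = 1"
    using Vy orthonormal_columns_norm[OF V] by simp
  then have "u \<bullet> (V *v y) \<le> norm ?w"
    using norm_cauchy_schwarz[of ?w y] inner_eq[of y] by simp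
  moreover have "\<bar>u \<bullet> (V *v y)\<bar> \<le> 1"
    using Cauchy_Schwarz_ineq2[of u "V *v y"] u Vy by simp
  ultimately show "arccos (norm ?w) \<le> z"
    unfolding z using w_le by (simp add: arccos_le_mono)
qed

lemma cone_angle_orthonormal_ranges:
  fixes U :: "real^'p^'n" and V :: "real^'q^'n"
  assumes U: "transpose U ** U = mat 1" and V: "transpose V ** V = mat 1"
  shows "cone_angle (range ((*v) U)) (range ((*v) V)) = arccos (min_modulus (transpose V ** U))"
proof -
  let ?A = "transpose V ** U"
  have sphere_eq: "range ((*v) U) \<inter> sphere 0 1 = (*v) U ` sphere 0 1"
    using orthonormal_columns_norm[OF U] by auto
  have "cone_angle (range ((*v) U)) (range ((*v) V)) = (SUP x \<in> sphere 0 1. arccos (norm (?A *v x)))"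
    unfolding cone_angle_def sphere_eq image_image
    by (rule SUP_cong) (simp_all add: INF_arccos_inner_orthonormal_range[OF V] orthonormal_columns_norm[OF U]
        matrix_vector_mul_assoc del: transpose_matrix_vector)
  also have "\<dots> = arccos (min_modulus ?A)"
  proof (rule cSup_eq_maximum)
    obtain x0 where "norm x0 = 1" "min_modulus ?A = norm (?A *v x0)"
      using min_modulus_attained by blast
    then show "arccos (min_modulus ?A) \<in> (\<lambda>x. arccos (norm (?A *v x))) ` sphere 0 1"
      by auto
  next
    fix z
    assume "z \<in> (\<lambda>x. arccos (norm (?A *v x))) ` sphere 0 1"
    then obtain x where "norm x = 1" "z = arccos (norm (?A *v x))"
      by auto
    then show "z \<le> arccos (min_modulus ?A)"
      using min_modulus_le[of x ?A] min_modulus_nonneg[of ?A] norm_transpose_mult_orthonormal_le[OF U V, of x]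
      by (simp add: arccos_le_mono)
  qed
  finally show ?thesis .
qed

lemma Dis_orthonormal_ranges:
  fixes U :: "real^'p^'n" and V :: "real^'q^'n"
  assumes "transpose U ** U = mat 1" and "transpose V ** V = mat 1"
  shows "Dis r (range ((*v) U)) (range ((*v) V)) =
    2 * lr_norm2 r (sin (arccos (min_modulus (transpose V ** U)) / 2))
                   (sin (arccos (min_modulus (transpose U ** V)) / 2))"
  unfolding Dis_def by (simp only: cone_angle_orthonormal_ranges assms)

lemma lr_norm2_commute: "lr_norm2 r a b = lr_norm2 r b a"
  unfolding lr_norm2_def by (simp add: max.commute add.commute)

lemma lr_norm2_diag:
  assumes "0 < r" and "0 \<le> s"
  shows "lr_norm2 r s s = lr_norm2 r 1 1 * s"
proof (cases r)
  case (real x)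
  then have "x > 0"
    using assms by simp
  have "(s powr x + s powr x) powr (1 / x) = 2 powr (1 / x) * (s powr x) powr (1 / x)"
    using \<open>0 \<le> s\<close> by (simp add: powr_mult)
  also have "\<dots> = 2 powr (1 / x) * s"
    using \<open>0 \<le> s\<close> \<open>x > 0\<close> by (simp add: powr_powr)
  finally show ?thesis
    using real \<open>0 \<le> s\<close> by (simp add: lr_norm2_def)
qed (use assms in \<open>auto simp: lr_norm2_def\<close>)

lemma sin_half_arccos_nonneg:
  assumes "0 \<le> c" "c \<le> 1"
  shows "sin (arccos c / 2) \<ge> 0"
  using assms arccos_lbound[of c] arccos_ubound[of c] by (intro sin_ge_zero) auto

theorem mainTheorem9:
  fixes U :: "real^'p^'n" and V :: "real^'q^'n" and r :: ereal
  assumes "1 \<le> r"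
    and "transpose U ** U = mat 1"
    and "transpose V ** V = mat 1"
  shows "(CARD('p) \<noteq> CARD('q) \<longrightarrow>
           Dis r (range ((*v) U)) (range ((*v) V))
             = 2 * lr_norm2 r (sqrt 2 / 2) (sin (theta_max U V / 2)))
       \<and> (CARD('p) = CARD('q) \<longrightarrow>
           Dis r (range ((*v) U)) (range ((*v) V))
             = 2 * lr_norm2 r 1 1 * sin (theta_max U V / 2))"
proof -
  define A where "A = transpose V ** U"
  have "transpose U ** V = transpose A"
    by (simp add: A_def matrix_transpose_mul)
  then have Dis_eq: "Dis r (range ((*v) U)) (range ((*v) V)) =
      2 * lr_norm2 r (sin (arccos (min_modulus A) / 2)) (sin (arccos (min_modulus (transpose A)) / 2))"
    using Dis_orthonormal_ranges[OF assms(2,3)] by (simp add: A_def)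
  have theta_eq: "theta_max U V = arccos (sigma_min A)"
    by (simp add: theta_max_def A_def)
  have "0 \<le> sin (arccos (min_modulus A) / 2)"
    unfolding A_def
    by (intro sin_half_arccos_nonneg min_modulus_nonneg min_modulus_transpose_mult_orthonormal_le_1 assms)
  moreover have "0 < r"
    by (rule less_le_trans[OF _ \<open>1 \<le> r\<close>]) simp
  ultimately show ?thesis
    using Dis_eq theta_eq min_modulus_transpose[of A]
    by (cases "CARD('p) < CARD('q)")
      (auto simp: sigma_min_eq_min_modulus min_modulus_eq_0_if_card_lt sin_45 lr_norm2_commute
        lr_norm2_diag[of r "sin (arccos (min_modulus A) / 2)"])
qed

end
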